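(* Consider the primal-dual pair (P)-(D) of multifold linear conic problems described in the context, and assume that strong duality holds for (P)-(D). Let $B,N,R^0,R,T$ and $B^0,N^0,B',N',O,C$ be the index sets defined in the context. Then $$T \supseteq B'\cup N'\cup O=(N^0\cup B^0)\setminus (N\cup B)\qquad\text{and}\qquad R\subseteq C=J\setminus (B^0\cup N^0).$$
   Context: Let $J=\{1,\dots,r\}$. For each $j\in J$ let $K_j\subset\mathbb{R}^{q_j}$ ($q_j\ge 1$) be a closed convex regular cone (regular: nonempty interior and pointed, i.e. containing no lines), $A^j\in\mathbb{R}^{q_j\times n}$, $b^j\in\mathbb{R}^{q_j}$, and let $c\in\mathbb{R}^n$. Put $K=K_1\times\cdots\times K_r$, let $A$ be the matrix obtained by stacking $A^1,\dots,A^r$ vertically, and $b=(b^1,\dots,b^r)$. For a set $Q\subseteq \mathbb{R}^m$, $Q^+=\{y\in\mathbb{R}^m : y^\top z\ge 0\ \forall z\in Q\}$. The problems are $$(P)\quad \min_{x\in\mathbb{R}^n} c^\top x\ \text{ s.t. } A^jx-b^j\in K_j\ \ \forall j\in J,$$ $$(D)\quad \max_{y=(y^1,\dots,y^r)} \sum_{j=1}^r (b^j)^\top y^j\ \text{ s.t. } \sum_{j=1}^r (A^j)^\top y^j=c,\ \ y^j\in K_j^+\ \ \forall j\in J.$$ Strong duality for (P)-(D) means that both optimal solution sets are nonempty and the duality gap is zero. Let $S(C)$ be the set of pairs $(x,y)$ satisfying the complementarity system: $A^jx-b^j\in K_j$, $y^j\in K_j^+$, $(y^j)^\top(A^jx-b^j)=0$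 for all $j\in J$, and $A^\top y=c$. Under strong duality $S(C)$ is the product of the optimal solution sets of (P) and (D). For a closed convex cone $Q$ and $s\in Q$, $N_Q(s)=\{v: v^\top(z-s)\le 0\ \forall z\in Q\}$ is the normal cone; $\operatorname{ri}$ is relative interior, $\operatorname{int}$ is interior. Four-partition $(B,N,R,T)$: $B=\{j\in J:\exists (x,y)\in S(C),\ A^jx-b^j\in\operatorname{int}K_j\}$, $N=\{j\in J:\exists (x,y)\in S(C),\ y^j\in\operatorname{int}K_j^+\}$, $R^0=\{j\in J:\exists (x,y)\in S(C),\ -y^j\in\operatorname{ri}N_{K_j}(A^jx-b^j)\}$, $R=R^0\setminus(B\cup N)$, $T=J\setminus R^0$. Six-partition $(B,N,B',N',O,C)$: $B^0=\{j\in J: y^j=0\ \forall (x,y)\in S(C)\}$, $N^0=\{j\in J: A^jx-b^j=0\ \forall (x,y)\in S(C)\}$, $B'=B^0\setminus(N^0\cup B)$, $N'=N^0\setminus(B^0\cup N)$, $O=B^0\cap N^0$, $C=J\setminus(B^0\cup N^0)$. *)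

theory Defs
  imports "HOL-Analysis.Analysis"
begin

text \<open>
  The spaces \<open>\<real>\<^bsup>q(j)\<^esup>\<close> have dimensions varying with \<open>j\<close>, so they are not modelled by separate
  types.  The type \<open>'m\<close> indexes the rows of the stacked system, and \<open>blk i\<close> is the number of the
  block to which row \<open>i\<close> belongs.  The space \<open>\<real>\<^bsup>q(j)\<^esup>\<close> is the coordinate subspace \<open>block_space blk j\<close>
  of \<open>real ^ 'm\<close>, with \<open>q(j) = card {i. blk i = j}\<close>.  Interiors, dual cones and normal cones of
  sets in \<open>\<real>\<^bsup>q(j)\<^esup>\<close> are therefore taken inside this subspace, which is passed explicitly as \<open>V\<close>
  below; closedness and the relative interior do not depend on the ambient space.
\<close>

definition block_space :: "('m::finite \<Rightarrow> nat) \<Rightarrow> nat \<Rightarrow> (real ^ 'm) set" where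
  "block_space blk j = {z. \<forall>i. blk i \<noteq> j \<longrightarrow> z $ i = 0}"

text \<open>
  Block \<open>j\<close> of a stacked object, padded by zeros.  It applies to vectors and, row-wise, to matrices.
\<close>

definition block :: "('m::finite \<Rightarrow> nat) \<Rightarrow> nat \<Rightarrow> 'a::zero ^ 'm \<Rightarrow> 'a ^ 'm" where
  "block blk j z = (\<chi> i. if blk i = j then z $ i else 0)"

definition int_in :: "'a::euclidean_space set \<Rightarrow> 'a set \<Rightarrow> 'a set" where
  "int_in V Q = (top_of_set V) interior_of Q"

definition dual_cone :: "'a::euclidean_space set \<Rightarrow> 'a set \<Rightarrow> 'a set" where
  "dual_cone V Q = {y \<in> V. \<forall>z\<in>Q. y \<bullet> z \<ge> 0}"

definition normal_cone :: "'a::euclidean_space set \<Rightarrow> 'a set \<Rightarrow> 'a \<Rightarrow> 'a set" where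
  "normal_cone V Q s = {v \<in> V. \<forall>z\<in>Q. v \<bullet> (z - s) \<le> 0}"

definition contains_line :: "'a::euclidean_space set \<Rightarrow> bool" where
  "contains_line Q \<longleftrightarrow> (\<exists>a d. d \<noteq> 0 \<and> (\<forall>t::real. a + t *\<^sub>R d \<in> Q))"

definition regular_cone :: "'a::euclidean_space set \<Rightarrow> 'a set \<Rightarrow> bool" where
  "regular_cone V Q \<longleftrightarrow> Q \<subseteq> V \<and> closed Q \<and> convex Q \<and> cone Q
     \<and> int_in V Q \<noteq> {} \<and> \<not> contains_line Q"

record ('m::finite, 'n::finite) conic_problem =
  nblk :: nat
  blk :: "'m \<Rightarrow> nat"
  Kcone :: "nat \<Rightarrow> (real ^ 'm) set"
  Amat :: "real ^ 'n ^ 'm"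
  bvec :: "real ^ 'm"
  cvec :: "real ^ 'n"

definition Jset :: "('m::finite, 'n::finite) conic_problem \<Rightarrow> nat set" where
  "Jset P = {1..nblk P}"

definition blkspace :: "('m::finite, 'n::finite) conic_problem \<Rightarrow> nat \<Rightarrow> (real ^ 'm) set" where
  "blkspace P j = block_space (blk P) j"

definition Ablk :: "('m::finite, 'n::finite) conic_problem \<Rightarrow> nat \<Rightarrow> real ^ 'n ^ 'm" where
  "Ablk P j = block (blk P) j (Amat P)"

definition bblk :: "('m::finite, 'n::finite) conic_problem \<Rightarrow> nat \<Rightarrow> real ^ 'm" where
  "bblk P j = block (blk P) j (bvec P)"

definition slack :: "('m::finite, 'n::finite) conic_problem \<Rightarrow> nat \<Rightarrow> real ^ 'n \<Rightarrow> real ^ 'm" where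
  "slack P j x = Ablk P j *v x - bblk P j"

definition yblk :: "('m::finite, 'n::finite) conic_problem \<Rightarrow> nat \<Rightarrow> real ^ 'm \<Rightarrow> real ^ 'm" where
  "yblk P j y = block (blk P) j y"

definition Kdual :: "('m::finite, 'n::finite) conic_problem \<Rightarrow> nat \<Rightarrow> (real ^ 'm) set" where
  "Kdual P j = dual_cone (blkspace P j) (Kcone P j)"

text \<open>The condition \<open>range (blk P) = Jset P\<close> says that every row lies in a block and that all \<open>q(j) \<ge> 1\<close>.\<close>

definition multifold_conic_problem :: "('m::finite, 'n::finite) conic_problem \<Rightarrow> bool" where
  "multifold_conic_problem P \<longleftrightarrow>
     range (blk P) = Jset P \<and> (\<forall>j\<in>Jset P. regular_cone (blkspace P j) (Kcone P j))"

definition primal_feasible :: "('m::finite, 'n::finite) conic_problem \<Rightarrow> (real ^ 'n) set" where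
  "primal_feasible P = {x. \<forall>j\<in>Jset P. slack P j x \<in> Kcone P j}"

definition dual_feasible :: "('m::finite, 'n::finite) conic_problem \<Rightarrow> (real ^ 'm) set" where
  "dual_feasible P = {y. (\<Sum>j\<in>Jset P. transpose (Ablk P j) *v yblk P j y) = cvec P
     \<and> (\<forall>j\<in>Jset P. yblk P j y \<in> Kdual P j)}"

definition primal_obj :: "('m::finite, 'n::finite) conic_problem \<Rightarrow> real ^ 'n \<Rightarrow> real" where
  "primal_obj P x = cvec P \<bullet> x"

definition dual_obj :: "('m::finite, 'n::finite) conic_problem \<Rightarrow> real ^ 'm \<Rightarrow> real" where
  "dual_obj P y = (\<Sum>j\<in>Jset P. bblk P j \<bullet> yblk P j y)"

definition primal_optimal :: "('m::finite, 'n::finite) conic_problem \<Rightarrow> (real ^ 'n) set" where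
  "primal_optimal P =
     {x \<in> primal_feasible P. \<forall>x'\<in>primal_feasible P. primal_obj P x \<le> primal_obj P x'}"

definition dual_optimal :: "('m::finite, 'n::finite) conic_problem \<Rightarrow> (real ^ 'm) set" where
  "dual_optimal P =
     {y \<in> dual_feasible P. \<forall>y'\<in>dual_feasible P. dual_obj P y' \<le> dual_obj P y}"

definition strong_duality :: "('m::finite, 'n::finite) conic_problem \<Rightarrow> bool" where
  "strong_duality P \<longleftrightarrow> primal_optimal P \<noteq> {} \<and> dual_optimal P \<noteq> {}
     \<and> (\<forall>x\<in>primal_optimal P. \<forall>y\<in>dual_optimal P. primal_obj P x = dual_obj P y)"

definition SC :: "('m::finite, 'n::finite) conic_problem \<Rightarrow> ((real ^ 'n) \<times> (real ^ 'm)) set" where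
  "SC P = {(x, y). (\<forall>j\<in>Jset P. slack P j x \<in> Kcone P j \<and> yblk P j y \<in> Kdual P j
                              \<and> yblk P j y \<bullet> slack P j x = 0)
                   \<and> transpose (Amat P) *v y = cvec P}"

definition part_B :: "('m::finite, 'n::finite) conic_problem \<Rightarrow> nat set" where
  "part_B P = {j \<in> Jset P. \<exists>(x, y)\<in>SC P. slack P j x \<in> int_in (blkspace P j) (Kcone P j)}"

definition part_N :: "('m::finite, 'n::finite) conic_problem \<Rightarrow> nat set" where
  "part_N P = {j \<in> Jset P. \<exists>(x, y)\<in>SC P. yblk P j y \<in> int_in (blkspace P j) (Kdual P j)}"

definition part_R0 :: "('m::finite, 'n::finite) conic_problem \<Rightarrow> nat set" where
  "part_R0 P = {j \<in> Jset P. \<exists>(x, y)\<in>SC P.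
     - yblk P j y \<in> rel_interior (normal_cone (blkspace P j) (Kcone P j) (slack P j x))}"

definition part_R :: "('m::finite, 'n::finite) conic_problem \<Rightarrow> nat set" where
  "part_R P = part_R0 P - (part_B P \<union> part_N P)"

definition part_T :: "('m::finite, 'n::finite) conic_problem \<Rightarrow> nat set" where
  "part_T P = Jset P - part_R0 P"

definition part_B0 :: "('m::finite, 'n::finite) conic_problem \<Rightarrow> nat set" where
  "part_B0 P = {j \<in> Jset P. \<forall>(x, y)\<in>SC P. yblk P j y = 0}"

definition part_N0 :: "('m::finite, 'n::finite) conic_problem \<Rightarrow> nat set" where
  "part_N0 P = {j \<in> Jset P. \<forall>(x, y)\<in>SC P. slack P j x = 0}"

definition part_B' :: "('m::finite, 'n::finite) conic_problem \<Rightarrow> nat set" where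
  "part_B' P = part_B0 P - (part_N0 P \<union> part_B P)"

definition part_N' :: "('m::finite, 'n::finite) conic_problem \<Rightarrow> nat set" where
  "part_N' P = part_N0 P - (part_B0 P \<union> part_N P)"

definition part_O :: "('m::finite, 'n::finite) conic_problem \<Rightarrow> nat set" where
  "part_O P = part_B0 P \<inter> part_N0 P"

definition part_C :: "('m::finite, 'n::finite) conic_problem \<Rightarrow> nat set" where
  "part_C P = Jset P - (part_B0 P \<union> part_N0 P)"

end

theory Submission
  imports Defs
begin

text \<open>
  Everything happens inside one block.  Let \<open>K\<close> be a regular cone in \<open>V \<noteq> {0}\<close> with dual cone
  \<open>K\<^sup>+\<close>, let \<open>(x, y)\<close> solve the complementarity system, and let \<open>s \<in> K\<close> and \<open>u \<in> K\<^sup>+\<close> be the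
  components of its slack and of \<open>y\<close> in this block.

  Neither \<open>K\<close> nor \<open>K\<^sup>+\<close> has the origin as an interior point.  A cone with \<open>0\<close> in its interior
  is the whole of \<open>V\<close>; but \<open>K = V\<close> is impossible as \<open>K\<close> contains no line, and \<open>K\<^sup>+ = V\<close> would
  force \<open>K = {0}\<close>, which has empty interior in \<open>V\<close>.  Hence no block of \<open>B\<close> has
  vanishing slacks and no block of \<open>N\<close> has vanishing multipliers.  This makes \<open>B\<close> disjoint from
  \<open>N\<^sup>0\<close> and \<open>N\<close> disjoint from \<open>B\<^sup>0\<close>, and the formula for \<open>B' \<union> N' \<union> O\<close> becomes set algebra.

  The condition \<open>-u \<in> ri N\<^sub>K(s)\<close> becomes an interiority condition as soon as one of \<open>u\<close>, \<open>s\<close>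
  vanishes.  If \<open>u = 0\<close>, then \<open>N\<^sub>K(s)\<close> has the origin in its relative interior, so together with
  each vector it contains a negative multiple; a hyperplane supporting \<open>K\<close> properly at \<open>s\<close> would
  contradict this, so \<open>s\<close> is interior to \<open>K\<close> (lemma
  \<open>interior_of_zero_rel_interior_normal_cone\<close>).  If \<open>s = 0\<close>, then \<open>N\<^sub>K(0) = -K\<^sup>+\<close>, and \<open>K\<^sup>+\<close>
  spans \<open>V\<close> because \<open>K\<close> is pointed, so \<open>u\<close> is interior to \<open>K\<^sup>+\<close> (lemma
  \<open>interior_dual_of_rel_interior_normal_cone\<close>).  Therefore \<open>R\<^sup>0 \<inter> B\<^sup>0 \<subseteq> B\<close> and
  \<open>R\<^sup>0 \<inter> N\<^sup>0 \<subseteq> N\<close>, from which both inclusions follow.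
\<close>

section \<open>Interiors of cones and of their duals\<close>

lemma rel_interior_eq_int_in_affine_hull: "rel_interior Q = int_in (affine hull Q) Q"
  unfolding rel_interior_def int_in_def interior_of_def by blast

lemma affine_hull_eq_if_int_in_nonempty:
  assumes V: "subspace V" and QV: "Q \<subseteq> V" and ne: "int_in V Q \<noteq> {}"
  shows "affine hull Q = V"
proof -
  have hullV: "affine hull V = V"
    using V by (simp add: affine_hull_eq subspace_imp_affine)
  have sub: "int_in V Q \<subseteq> Q"
    by (simp add: int_in_def interior_of_subset)
  have "openin (top_of_set V) (int_in V Q)"
    by (simp add: int_in_def)
  then have "affine hull (int_in V Q) = V"
    using affine_hull_openin[of V "int_in V Q"] hullV ne by simp
  then show ?thesis
    using hull_mono[OF sub, of affine] hull_mono[OF QV, of affine] hullV by auto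
qed

lemma cone_eq_space_if_zero_interior:
  assumes V: "subspace V" and K: "cone K" and z: "0 \<in> int_in V K"
  shows "V \<subseteq> K"
proof
  fix v assume v: "v \<in> V"
  from z obtain U where U: "openin (top_of_set V) U" "0 \<in> U" "U \<subseteq> K"
    unfolding int_in_def interior_of_def by blast
  then obtain e where e: "e > 0" "ball 0 e \<inter> V \<subseteq> U"
    using openin_contains_ball[of V U] by auto
  show "v \<in> K"
  proof (cases "v = 0")
    case True
    then show ?thesis using U by auto
  next
    case False
    define t where "t = e / (2 * norm v)"
    have t: "t > 0" using e False by (simp add: t_def)
    have "norm (t *\<^sub>R v) < e" using e False by (simp add: t_def)
    then have "t *\<^sub>R v \<in> ball 0 e \<inter> V"
      using v subspace_scale[OF V] by simp
    then have "t *\<^sub>R v \<in> K"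
      using e U by blast
    then have "inverse t *\<^sub>R (t *\<^sub>R v) \<in> K"
      using K t unfolding cone_def by (meson inverse_nonnegative_iff_nonnegative less_imp_le)
    then show ?thesis using t by simp
  qed
qed

lemma zero_not_interior_regular_cone:
  assumes V: "subspace V" "V \<noteq> {0}" and K: "regular_cone V K"
  shows "0 \<notin> int_in V K"
proof
  assume "0 \<in> int_in V K"
  then have VK: "V \<subseteq> K"
    using cone_eq_space_if_zero_interior V(1) K unfolding regular_cone_def by blast
  obtain d where d: "d \<in> V" "d \<noteq> 0"
    using V subspace_0 by blast
  then have "\<forall>t::real. 0 + t *\<^sub>R d \<in> K"
    using VK subspace_scale[OF V(1)] by auto
  then show False
    using K d unfolding regular_cone_def contains_line_def by blast
qed

lemma cone_dual_cone: "subspace V \<Longrightarrow> cone (dual_cone V Q)"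
  unfolding cone_def dual_cone_def by (auto simp: subspace_scale)

lemma zero_not_interior_dual_cone:
  assumes V: "subspace V" "V \<noteq> {0}" and K: "regular_cone V K"
  shows "0 \<notin> int_in V (dual_cone V K)"
proof
  assume "0 \<in> int_in V (dual_cone V K)"
  then have dual: "V \<subseteq> dual_cone V K"
    using cone_eq_space_if_zero_interior cone_dual_cone V(1) by blast
  have KV: "K \<subseteq> V" and ne: "int_in V K \<noteq> {}"
    using K unfolding regular_cone_def by auto
  have "z = 0" if "z \<in> K" for z
  proof -
    have "- z \<in> dual_cone V K"
      using dual KV that subspace_neg[OF V(1)] by blast
    then have "(- z) \<bullet> z \<ge> 0"
      using that unfolding dual_cone_def by blast
    moreover have "z \<bullet> z \<ge> 0" by simp
    ultimately have "z \<bullet> z = 0" unfolding inner_minus_left by linarith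
    then show ?thesis by simp
  qed
  moreover have "int_in V K \<subseteq> K"
    by (simp add: int_in_def interior_of_subset)
  ultimately have "0 \<in> int_in V K"
    using ne by blast
  then show False
    using zero_not_interior_regular_cone[OF V K] by simp
qed

section \<open>Relative interiors of normal cones\<close>

text \<open>
  The orthogonal projection of \<open>a\<close> onto \<open>V\<close>.  It turns separating functionals of the ambient space
  into vectors of \<open>V\<close>, where dual and normal cones live.
\<close>

lemma subspace_represents_functional:
  fixes a :: "'a::euclidean_space"
  assumes "subspace V"
  obtains v where "v \<in> V" "\<And>w. w \<in> V \<Longrightarrow> v \<bullet> w = a \<bullet> w"
proof -
  obtain v z where v: "v \<in> span V" and z: "\<And>w. w \<in> span V \<Longrightarrow> orthogonal z w" and a: "a = v + z"
    using orthogonal_subspace_decomp_exists[of V a] by metis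
  show ?thesis
  proof
    show "v \<in> V"
      using v assms span_eq_iff by blast
    show "v \<bullet> w = a \<bullet> w" if "w \<in> V" for w
      using z[OF span_base[OF that]] a by (simp add: orthogonal_def inner_add_left)
  qed
qed

text \<open>
  If \<open>s\<close> were not interior, a proper supporting hyperplane at \<open>s\<close> would give a normal vector whose
  negative multiples are not normal.
\<close>

lemma interior_of_zero_rel_interior_normal_cone:
  assumes V: "subspace V" and K: "regular_cone V K" and s: "s \<in> K"
    and z: "0 \<in> rel_interior (normal_cone V K s)"
  shows "s \<in> int_in V K"
proof (rule ccontr)
  assume "s \<notin> int_in V K"
  moreover have KV: "K \<subseteq> V" and convK: "convex K" and ne: "int_in V K \<noteq> {}"
    using K unfolding regular_cone_def by auto
  have ri: "rel_interior K = int_in V K"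
    using affine_hull_eq_if_int_in_nonempty[OF V KV ne] rel_interior_eq_int_in_affine_hull[of K]
    by simp
  ultimately obtain a where a: "\<And>w. w \<in> K \<Longrightarrow> a \<bullet> s \<le> a \<bullet> w"
    and strict: "\<And>w. w \<in> rel_interior K \<Longrightarrow> a \<bullet> s < a \<bullet> w"
    using supporting_hyperplane_rel_boundary[OF convK s] by metis
  obtain v where v: "v \<in> V" and va: "\<And>w. w \<in> V \<Longrightarrow> v \<bullet> w = a \<bullet> w"
    using subspace_represents_functional[OF V, of a] by blast
  have v_diff: "v \<bullet> (w - s) = a \<bullet> w - a \<bullet> s" if "w \<in> K" for w
    using va[of "w - s"] that s KV subspace_diff[OF V] by (auto simp: inner_diff_right)
  have "- v \<in> normal_cone V K s"
    unfolding normal_cone_def using v subspace_neg[OF V] v_diff a by auto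
  moreover have "convex (normal_cone V K s)"
    unfolding normal_cone_def convex_def
    by (auto simp: inner_add_left subspace_add[OF V] subspace_scale[OF V]
        intro!: add_nonpos_nonpos mult_nonneg_nonpos)
  ultimately obtain e where e: "e > 1" and "(1 - e) *\<^sub>R (- v) + e *\<^sub>R 0 \<in> normal_cone V K s"
    using convex_rel_interior_iff[of "normal_cone V K s" 0] z by (metis empty_iff)
  then have "(e - 1) *\<^sub>R v \<in> normal_cone V K s"
    by (simp add: algebra_simps)
  moreover obtain w where w: "w \<in> int_in V K"
    using ne by blast
  have wK: "w \<in> K"
    using w interior_of_subset[of "top_of_set V" K] unfolding int_in_def by blast
  ultimately have "(e - 1) * (v \<bullet> (w - s)) \<le> 0"
    unfolding normal_cone_def by simp
  moreover have "(e - 1) * (v \<bullet> (w - s)) > 0"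
    using e strict[of w] w ri v_diff[OF wK] by simp
  ultimately show False by linarith
qed

text \<open>One half of the bipolar theorem, relative to \<open>V\<close>.\<close>

lemma bidual_cone_subset:
  assumes V: "subspace V" and KV: "K \<subseteq> V"
    and K: "closed K" "convex K" "cone K" "K \<noteq> {}"
    and w: "w \<in> V" and dual: "\<And>y. y \<in> dual_cone V K \<Longrightarrow> y \<bullet> w \<ge> 0"
  shows "w \<in> K"
proof (rule ccontr)
  assume "w \<notin> K"
  then obtain a b where ab: "a \<bullet> w < b" "\<And>z. z \<in> K \<Longrightarrow> a \<bullet> z > b"
    using separating_hyperplane_closed_point[OF K(2,1)] by blast
  have "0 \<in> K"
    using K(3,4) cone_contains_0 by blast
  then have b: "b < 0"
    using ab(2)[of 0] by simp
  have pos: "a \<bullet> z \<ge> 0" if "z \<in> K" for z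
  proof (rule ccontr)
    assume "\<not> a \<bullet> z \<ge> 0"
    then have neg: "a \<bullet> z < 0" by simp
    \<comment> \<open>The multiple of \<open>z\<close> on which \<open>a\<close> takes the value \<open>b\<close>.\<close>
    have "(b / (a \<bullet> z)) *\<^sub>R z \<in> K"
      using K(3) that b neg unfolding cone_def by (simp add: divide_nonpos_neg)
    from ab(2)[OF this] show False
      using neg by simp
  qed
  obtain v where v: "v \<in> V" and va: "\<And>z. z \<in> V \<Longrightarrow> v \<bullet> z = a \<bullet> z"
    using subspace_represents_functional[OF V, of a] by blast
  have "v \<in> dual_cone V K"
    unfolding dual_cone_def using v va pos KV by auto
  then have "a \<bullet> w \<ge> 0"
    using dual va[OF w] by fastforce
  then show False using ab(1) b by simp
qed

text \<open>
  A vector of \<open>V\<close> orthogonal to the dual cone lies, by biduality, in \<open>K\<close> together with its negative,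
  and thus spans a line of \<open>K\<close>.
\<close>

lemma affine_hull_dual_cone:
  assumes V: "subspace V" and K: "regular_cone V K"
  shows "affine hull (dual_cone V K) = V"
proof -
  let ?D = "dual_cone V K"
  have KV: "K \<subseteq> V" and closedK: "closed K" and convK: "convex K" and coneK: "cone K"
    and ne: "K \<noteq> {}" and noline: "\<not> contains_line K"
    using K interior_of_subset[of "top_of_set V" K] unfolding regular_cone_def int_in_def by auto
  have spanV: "span V = V"
    using V span_eq_iff by blast
  have DV: "span ?D \<subseteq> V"
    using V by (intro span_minimal) (auto simp: dual_cone_def)
  have "span ?D = V"
  proof (rule ccontr)
    assume "span ?D \<noteq> V"
    then have "span ?D \<subset> span V"
      unfolding spanV using DV by blast
    then obtain d where d: "d \<noteq> 0" "d \<in> V" and orth: "\<And>y. y \<in> span ?D \<Longrightarrow> orthogonal d y"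
      using orthogonal_to_subspace_exists_gen[of ?D V] spanV by metis
    have "0 + t *\<^sub>R d \<in> K" for t :: real
    proof (rule bidual_cone_subset[OF V KV closedK convK coneK ne])
      show "0 + t *\<^sub>R d \<in> V"
        using d subspace_scale[OF V] by simp
      show "y \<bullet> (0 + t *\<^sub>R d) \<ge> 0" if "y \<in> ?D" for y
        using orth[OF span_base[OF that]] by (simp add: orthogonal_def inner_commute)
    qed
    then show False
      using noline d unfolding contains_line_def by blast
  qed
  moreover have "0 \<in> ?D"
    using subspace_0[OF V] by (simp add: dual_cone_def)
  ultimately show ?thesis
    using affine_hull_span_0[of ?D] hull_inc[of 0 ?D] by simp
qed

text \<open>
  At the apex the normal cone is the negative of the dual cone, whose relative interior is its
  interior in \<open>V\<close> because it spans \<open>V\<close>.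
\<close>

lemma interior_dual_of_rel_interior_normal_cone:
  assumes V: "subspace V" and K: "regular_cone V K"
    and u: "- u \<in> rel_interior (normal_cone V K 0)"
  shows "u \<in> int_in V (dual_cone V K)"
proof -
  have "normal_cone V K 0 = uminus ` dual_cone V K"
  proof (intro equalityI subsetI)
    fix v assume "v \<in> normal_cone V K 0"
    then have "- v \<in> dual_cone V K"
      using subspace_neg[OF V] by (auto simp: normal_cone_def dual_cone_def)
    then show "v \<in> uminus ` dual_cone V K"
      by (metis image_eqI minus_minus)
  qed (use subspace_neg[OF V] in \<open>auto simp: normal_cone_def dual_cone_def\<close>)
  then have "- u \<in> uminus ` rel_interior (dual_cone V K)"
    using u rel_interior_injective_linear_image[of uminus "dual_cone V K"]
    by (simp add: bounded_linear_minus)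
  then have "u \<in> rel_interior (dual_cone V K)" by auto
  then show ?thesis
    using rel_interior_eq_int_in_affine_hull[of "dual_cone V K"] affine_hull_dual_cone[OF V K]
    by simp
qed

section \<open>Relations between the index sets\<close>

lemma subspace_blkspace: "subspace (blkspace P j)"
  unfolding blkspace_def block_space_def subspace_def by auto

lemma blkspace_nontrivial:
  assumes "multifold_conic_problem P" "j \<in> Jset P"
  shows "blkspace P j \<noteq> {0}"
proof -
  obtain i where i: "blk P i = j"
    using assms unfolding multifold_conic_problem_def by (metis rangeE)
  then have "axis i 1 \<in> blkspace P j"
    unfolding blkspace_def block_space_def by (auto simp: axis_def)
  moreover have "axis i (1::real) \<noteq> 0"
    by simp
  ultimately show ?thesis by blast
qed

lemma regular_cone_Kcone:
  "multifold_conic_problem P \<Longrightarrow> j \<in> Jset P \<Longrightarrow> regular_cone (blkspace P j) (Kcone P j)"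
  unfolding multifold_conic_problem_def by blast

lemma part_B_disjoint_part_N0:
  assumes "multifold_conic_problem P"
  shows "part_B P \<inter> part_N0 P = {}"
proof (rule equals0I)
  fix j assume j: "j \<in> part_B P \<inter> part_N0 P"
  then obtain x y where J: "j \<in> Jset P" and xy: "(x, y) \<in> SC P"
    and int: "slack P j x \<in> int_in (blkspace P j) (Kcone P j)"
    unfolding part_B_def by blast
  have "slack P j x = 0"
    using j xy unfolding part_N0_def by blast
  then show False
    using int zero_not_interior_regular_cone[OF subspace_blkspace blkspace_nontrivial[OF assms J]
        regular_cone_Kcone[OF assms J]] by simp
qed

lemma part_N_disjoint_part_B0:
  assumes "multifold_conic_problem P"
  shows "part_N P \<inter> part_B0 P = {}"
proof (rule equals0I)
  fix j assume j: "j \<in> part_N P \<inter> part_B0 P"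
  then obtain x y where J: "j \<in> Jset P" and xy: "(x, y) \<in> SC P"
    and int: "yblk P j y \<in> int_in (blkspace P j) (Kdual P j)"
    unfolding part_N_def by blast
  have "yblk P j y = 0"
    using j xy unfolding part_B0_def by blast
  then show False
    using int zero_not_interior_dual_cone[OF subspace_blkspace blkspace_nontrivial[OF assms J]
        regular_cone_Kcone[OF assms J]] unfolding Kdual_def by simp
qed

lemma part_R0_inter_part_B0_subset:
  assumes "multifold_conic_problem P"
  shows "part_R0 P \<inter> part_B0 P \<subseteq> part_B P"
proof
  fix j assume j: "j \<in> part_R0 P \<inter> part_B0 P"
  then obtain x y where J: "j \<in> Jset P" and xy: "(x, y) \<in> SC P"
    and ri: "- yblk P j y \<in> rel_interior (normal_cone (blkspace P j) (Kcone P j) (slack P j x))"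
    unfolding part_R0_def by blast
  have y0: "yblk P j y = 0"
    using j xy unfolding part_B0_def by blast
  have "slack P j x \<in> Kcone P j"
    using xy J unfolding SC_def by blast
  then have "slack P j x \<in> int_in (blkspace P j) (Kcone P j)"
    using interior_of_zero_rel_interior_normal_cone subspace_blkspace
      regular_cone_Kcone[OF assms J] ri y0 by (metis minus_zero)
  then show "j \<in> part_B P"
    using J xy unfolding part_B_def by blast
qed

lemma part_R0_inter_part_N0_subset:
  assumes "multifold_conic_problem P"
  shows "part_R0 P \<inter> part_N0 P \<subseteq> part_N P"
proof
  fix j assume j: "j \<in> part_R0 P \<inter> part_N0 P"
  then obtain x y where J: "j \<in> Jset P" and xy: "(x, y) \<in> SC P"
    and ri: "- yblk P j y \<in> rel_interior (normal_cone (blkspace P j) (Kcone P j) (slack P j x))"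
    unfolding part_R0_def by blast
  have s0: "slack P j x = 0"
    using j xy unfolding part_N0_def by blast
  have "yblk P j y \<in> int_in (blkspace P j) (Kdual P j)"
    using interior_dual_of_rel_interior_normal_cone[OF subspace_blkspace
        regular_cone_Kcone[OF assms J]] ri s0 unfolding Kdual_def by metis
  then show "j \<in> part_N P"
    using J xy unfolding part_N_def by blast
qed

theorem theorem2:
  fixes P :: "('m::finite, 'n::finite) conic_problem"
  assumes "multifold_conic_problem P"
    and "strong_duality P"
  shows "part_B' P \<union> part_N' P \<union> part_O P \<subseteq> part_T P
       \<and> part_B' P \<union> part_N' P \<union> part_O P = (part_N0 P \<union> part_B0 P) - (part_N P \<union> part_B P)
       \<and> part_R P \<subseteq> part_C P
       \<and> part_C P = Jset P - (part_B0 P \<union> part_N0 P)"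
proof -
  note disjoint = part_B_disjoint_part_N0[OF assms(1)] part_N_disjoint_part_B0[OF assms(1)]
  have degenerate: "part_B' P \<union> part_N' P \<union> part_O P =
      (part_N0 P \<union> part_B0 P) - (part_N P \<union> part_B P)"
    unfolding part_B'_def part_N'_def part_O_def using disjoint by blast
  have R0: "part_R0 P \<inter> (part_N0 P \<union> part_B0 P) \<subseteq> part_N P \<union> part_B P"
    using part_R0_inter_part_B0_subset[OF assms(1)] part_R0_inter_part_N0_subset[OF assms(1)]
    by blast
  have J: "part_N0 P \<union> part_B0 P \<subseteq> Jset P" "part_R0 P \<subseteq> Jset P"
    unfolding part_N0_def part_B0_def part_R0_def by auto
  have "part_B' P \<union> part_N' P \<union> part_O P \<subseteq> part_T P"
    unfolding degenerate part_T_def using R0 J by blast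
  moreover have "part_R P \<subseteq> part_C P"
    unfolding part_R_def part_C_def using R0 J by blast
  ultimately show ?thesis
    using degenerate part_C_def[of P] by blast
qed

end
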